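(* Fix $0<\delta<1/2$, put $s=1-2\delta$, and restrict the balanced family to $x=1/2$, so that $\eta=\rho=\sin^2(t/2)$ with $0\le t<\pi/2$. Write $\tau=\sin t$. For $0\le\tau\le s$, the spectral boundary $\Gamma_{\mathrm{HC}}=s$ of this family is given by $$P=\frac{s-\tau}{1-\tau},\qquad E^2=(1+\tau)(s-\tau),$$ and its objective is $$\Phi_{\mathrm{bal}}\big(\tfrac12,t;\delta\big)=F_\delta(\tau).$$ Consequently, the infimum of the symmetric honeycomb slice, i.e. the infimum of $\Phi_{\mathrm{HC}}$ over the points of $\mathcal D_{\mathrm{HC}}$ with $x=\frac12$, $\eta=\rho$ and $\Gamma_{\mathrm{HC}}>s$, is exactly $M_2(\delta)$, and $$\kappa_{\mathrm{HC}}(\delta)\le\kappa_{\mathrm{bal}}(\delta)\le M_2(\delta).$$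
   Context: $H_2(t)=-t\log_2t-(1-t)\log_2(1-t)$ ($0\log_20=0$) and $g(q)=H_2\big(\frac{1-\sqrt{1-q}}2\big)$ for $0\le q\le1$. $F_\delta(\tau)=1+g(\tau^2)-g(\tau^2+2\delta\tau+2\delta)$ for $0\le\tau\le1-2\delta$, and $M_2(\delta)=\min_{0\le\tau\le1-2\delta}F_\delta(\tau)$. For $0<x\le\frac12$, $0\le\eta,\rho<\frac12$, $0\le z\le\frac12$ put $A=(1-x)(1-2\eta)$, $B=x(1-2\rho)$, $E=1-2z$; $\mathcal D_{\mathrm{HC}}$ is the set of such $(x,\eta,\rho,z)$ with $|A-B|\le E\le A+B$. Put $P=\frac{E^2-(A-B)^2}{4AB}$, $$\Gamma_{\mathrm{HC}}=2\sqrt{x(1-x)}\Big[P\big(\sqrt{(1-\eta)(1-\rho)}+\sqrt{\eta\rho}\big)+(1-P)\big(\sqrt{\rho(1-\eta)}+\sqrt{\eta(1-\rho)}\big)\Big],$$ $\Phi_{\mathrm{HC}}=H_2(x)+(1-x)H_2(\eta)+xH_2(\rho)-H_2(z)$, and $\kappa_{\mathrm{HC}}(\delta)=\inf\{\Phi_{\mathrm{HC}}:(x,\eta,\rho,z)\in\mathcal D_{\mathrm{HC}},\ \Gamma_{\mathrm{HC}}>1-2\delta\}$. Balanced family: for $0<x\le\frac12$, $0<t<\frac{\pi}{4(1-x)}$ take $\eta=\sin^2(xt)$, $\rho=\sin^2((1-x)t)$; let $S_+=\sqrt{x(1-x)}\cos((1-2x)t)$, $S_-=\sqrt{x(1-x)}\sin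 t$, $A_{\mathrm{bal}}=(1-x)\cos(2xt)$, $B_{\mathrm{bal}}=x\cos(2(1-x)t)$, $$P_{\mathrm{bal}}=\frac{(1-2\delta)/2-S_-}{S_+-S_-},\quad E_{\mathrm{bal}}=\sqrt{(A_{\mathrm{bal}}-B_{\mathrm{bal}})^2+4A_{\mathrm{bal}}B_{\mathrm{bal}}P_{\mathrm{bal}}},\quad z_{\mathrm{bal}}=\frac{1-E_{\mathrm{bal}}}2,$$ $\Phi_{\mathrm{bal}}(x,t;\delta)=H_2(x)+(1-x)H_2(\sin^2(xt))+xH_2(\sin^2((1-x)t))-H_2(z_{\mathrm{bal}})$; endpoint values (such as $t=0$) are given by the same formulas. $\kappa_{\mathrm{bal}}(\delta)$ is the infimum of $\Phi_{\mathrm{bal}}(x,t;\delta)$ over pairs $(x,t)$ with $0<x\le\frac12$, $0<t<\frac\pi{4(1-x)}$, $0<P_{\mathrm{bal}}<1$, $0<E_{\mathrm{bal}}<1$. *)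

theory Defs
  imports Complex_Main
begin

(* The convention 0 * log 0 = 0 holds automatically, since 0 * y = 0. *)
definition H2 :: "real \<Rightarrow> real" where
  "H2 t = - t * log 2 t - (1 - t) * log 2 (1 - t)"

definition g :: "real \<Rightarrow> real" where
  "g q = H2 ((1 - sqrt (1 - q)) / 2)"

definition F :: "real \<Rightarrow> real \<Rightarrow> real" where
  "F \<delta> \<tau> = 1 + g (\<tau>\<^sup>2) - g (\<tau>\<^sup>2 + 2 * \<delta> * \<tau> + 2 * \<delta>)"

(* A minimum, not merely an infimum: LEAST denotes the smallest element of the range. *)
definition M2 :: "real \<Rightarrow> real" where
  "M2 \<delta> = (LEAST m. m \<in> F \<delta> ` {0..1 - 2 * \<delta>})"

definition A_HC :: "real \<Rightarrow> real \<Rightarrow> real" where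
  "A_HC x \<eta> = (1 - x) * (1 - 2 * \<eta>)"

definition B_HC :: "real \<Rightarrow> real \<Rightarrow> real" where
  "B_HC x \<rho> = x * (1 - 2 * \<rho>)"

definition E_HC :: "real \<Rightarrow> real" where
  "E_HC z = 1 - 2 * z"

definition D_HC :: "(real \<times> real \<times> real \<times> real) set" where
  "D_HC = {(x, \<eta>, \<rho>, z).
     0 < x \<and> x \<le> 1/2 \<and> 0 \<le> \<eta> \<and> \<eta> < 1/2 \<and> 0 \<le> \<rho> \<and> \<rho> < 1/2 \<and> 0 \<le> z \<and> z \<le> 1/2 \<and>
     \<bar>A_HC x \<eta> - B_HC x \<rho>\<bar> \<le> E_HC z \<and> E_HC z \<le> A_HC x \<eta> + B_HC x \<rho>}"

definition P_HC :: "real \<Rightarrow> real \<Rightarrow> real \<Rightarrow> real \<Rightarrow> real" where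
  "P_HC x \<eta> \<rho> z =
     ((E_HC z)\<^sup>2 - (A_HC x \<eta> - B_HC x \<rho>)\<^sup>2) / (4 * A_HC x \<eta> * B_HC x \<rho>)"

definition Gamma_HC :: "real \<Rightarrow> real \<Rightarrow> real \<Rightarrow> real \<Rightarrow> real" where
  "Gamma_HC x \<eta> \<rho> z = 2 * sqrt (x * (1 - x)) *
     (P_HC x \<eta> \<rho> z * (sqrt ((1 - \<eta>) * (1 - \<rho>)) + sqrt (\<eta> * \<rho>)) +
      (1 - P_HC x \<eta> \<rho> z) * (sqrt (\<rho> * (1 - \<eta>)) + sqrt (\<eta> * (1 - \<rho>))))"

definition Phi_HC :: "real \<Rightarrow> real \<Rightarrow> real \<Rightarrow> real \<Rightarrow> real" where
  "Phi_HC x \<eta> \<rho> z = H2 x + (1 - x) * H2 \<eta> + x * H2 \<rho> - H2 z"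

definition kappa_HC :: "real \<Rightarrow> real" where
  "kappa_HC \<delta> = Inf {Phi_HC x \<eta> \<rho> z | x \<eta> \<rho> z.
     (x, \<eta>, \<rho>, z) \<in> D_HC \<and> Gamma_HC x \<eta> \<rho> z > 1 - 2 * \<delta>}"

definition eta_bal :: "real \<Rightarrow> real \<Rightarrow> real" where
  "eta_bal x t = (sin (x * t))\<^sup>2"

definition rho_bal :: "real \<Rightarrow> real \<Rightarrow> real" where
  "rho_bal x t = (sin ((1 - x) * t))\<^sup>2"

definition S_plus :: "real \<Rightarrow> real \<Rightarrow> real" where
  "S_plus x t = sqrt (x * (1 - x)) * cos ((1 - 2 * x) * t)"

definition S_minus :: "real \<Rightarrow> real \<Rightarrow> real" where
  "S_minus x t = sqrt (x * (1 - x)) * sin t"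

definition A_bal :: "real \<Rightarrow> real \<Rightarrow> real" where
  "A_bal x t = (1 - x) * cos (2 * x * t)"

definition B_bal :: "real \<Rightarrow> real \<Rightarrow> real" where
  "B_bal x t = x * cos (2 * (1 - x) * t)"

definition P_bal :: "real \<Rightarrow> real \<Rightarrow> real \<Rightarrow> real" where
  "P_bal x t \<delta> = ((1 - 2 * \<delta>) / 2 - S_minus x t) / (S_plus x t - S_minus x t)"

definition E_bal :: "real \<Rightarrow> real \<Rightarrow> real \<Rightarrow> real" where
  "E_bal x t \<delta> =
     sqrt ((A_bal x t - B_bal x t)\<^sup>2 + 4 * A_bal x t * B_bal x t * P_bal x t \<delta>)"

definition z_bal :: "real \<Rightarrow> real \<Rightarrow> real \<Rightarrow> real" where
  "z_bal x t \<delta> = (1 - E_bal x t \<delta>) / 2"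

definition Phi_bal :: "real \<Rightarrow> real \<Rightarrow> real \<Rightarrow> real" where
  "Phi_bal x t \<delta> =
     H2 x + (1 - x) * H2 (eta_bal x t) + x * H2 (rho_bal x t) - H2 (z_bal x t \<delta>)"

definition kappa_bal :: "real \<Rightarrow> real" where
  "kappa_bal \<delta> = Inf {Phi_bal x t \<delta> | x t.
     0 < x \<and> x \<le> 1/2 \<and> 0 < t \<and> t < pi / (4 * (1 - x)) \<and>
     0 < P_bal x t \<delta> \<and> P_bal x t \<delta> < 1 \<and> 0 < E_bal x t \<delta> \<and> E_bal x t \<delta> < 1}"

end

theory Submission
  imports Defs "HOL-Real_Asymp.Real_Asymp" "HOL-Analysis.Analysis"
begin

text \<open>
  On the slice \<open>x = 1/2\<close>, \<open>\<eta> = \<rho>\<close>, with \<open>\<tau> = 2 sqrt (\<eta> (1 - \<eta>))\<close>, one has \<open>A = B = sqrt (1 - \<tau>^2) / 2\<close>,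
  hence \<open>P = E^2 / (1 - \<tau>^2)\<close> and \<open>\<Gamma> = \<tau> + E^2 / (1 + \<tau>)\<close>; the boundary \<open>\<Gamma> = s\<close> therefore reads
  \<open>E^2 = (1 + \<tau>) (s - \<tau>)\<close>, where \<open>\<Phi> = F \<delta> \<tau>\<close>. Inside \<open>\<Gamma> > s\<close> with \<open>\<tau> \<le> s\<close> the entropy \<open>H2 z\<close> is
  smaller than on the boundary, and for \<open>\<tau> > s\<close> already \<open>H2 \<eta> \<ge> F \<delta> s\<close>. Conversely \<open>\<Gamma>\<close> strictly
  increases as \<open>z\<close> decreases, so every boundary point with \<open>z > 0\<close>, \<open>E < A + B\<close> is a limit of points of
  the open region; applied to all balanced points this gives the comparison of the infima.
\<close>

section \<open>Binary entropy\<close>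

lemma H2_0 [simp]: "H2 0 = 0"
  by (simp add: H2_def)

lemma H2_half [simp]: "H2 (1/2) = 1"
  by (simp add: H2_def log_def ln_div)

lemma H2_symmetric: "H2 (1 - t) = H2 t"
  by (simp add: H2_def algebra_simps)

lemma DERIV_H2:
  assumes "0 < t" "t < 1"
  shows "(H2 has_real_derivative (ln (1 - t) - ln t) / ln 2) (at t)"
proof -
  have "((\<lambda>t. (- (t * ln t) - (1 - t) * ln (1 - t)) / ln 2) has_real_derivative
      (ln (1 - t) - ln t) / ln 2) (at t)"
    using assms by (auto intro!: derivative_eq_intros)
  moreover have "H2 = (\<lambda>t. (- (t * ln t) - (1 - t) * ln (1 - t)) / ln 2)"
    by (simp add: H2_def log_def fun_eq_iff diff_divide_distrib)
  ultimately show ?thesis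
    by simp
qed

text \<open>Differentiability stops short of the ends; the closed interval is needed because
  \<open>\<tau> = 0\<close> makes \<open>g\<close> evaluate \<open>H2\<close> at 0.\<close>

lemma continuous_on_H2: "continuous_on {0..1} H2"
proof -
  have pos: "continuous_on {0..1} (\<lambda>t::real. t * ln t)"
    unfolding continuous_on_def
  proof
    fix t :: real assume t: "t \<in> {0..1}"
    show "((\<lambda>t. t * ln t) \<longlongrightarrow> t * ln t) (at t within {0..1})"
    proof (cases "t = 0")
      case True
      \<comment> \<open>The product is 0 at 0 whatever \<open>ln 0\<close> is, so continuity there
        is exactly this limit.\<close>
      have "((\<lambda>t::real. t * ln t) \<longlongrightarrow> 0) (at_right 0)"
        by real_asymp
      moreover have "at (0::real) within {0..1} = at_right 0"
        by (rule at_within_Icc_at_right) simp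
      ultimately show ?thesis
        using True by simp
    next
      case False
      then show ?thesis
        using t by (auto intro!: tendsto_intros)
    qed
  qed
  have neg: "continuous_on {0..1} (\<lambda>t::real. (1 - t) * ln (1 - t))"
    by (rule continuous_on_compose2[OF pos, where f = "\<lambda>t. 1 - t"])
      (auto intro!: continuous_intros)
  have "H2 t = - (t * ln t) / ln 2 - (1 - t) * ln (1 - t) / ln 2" for t
    by (simp add: H2_def log_def)
  then have eq: "H2 = (\<lambda>t. - (t * ln t) / ln 2 - (1 - t) * ln (1 - t) / ln 2)"
    by blast
  show ?thesis
    unfolding eq by (intro continuous_intros pos neg) auto
qed

lemma H2_mono:
  assumes "0 \<le> a" "a \<le> b" "b \<le> 1/2"
  shows "H2 a \<le> H2 b"
proof (rule DERIV_nonneg_imp_increasing_open[OF assms(2)])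
  fix t assume t: "a < t" "t < b"
  then have "ln t \<le> ln (1 - t)"
    using assms by (subst ln_le_cancel_iff) auto
  then show "\<exists>y. (H2 has_real_derivative y) (at t) \<and> 0 \<le> y"
    using DERIV_H2[of t] t assms by (intro exI[of _ "(ln (1 - t) - ln t) / ln 2"]) auto
next
  show "continuous_on {a..b} H2"
    using assms by (intro continuous_on_subset[OF continuous_on_H2]) auto
qed

lemma H2_bounds:
  assumes "0 \<le> t" "t \<le> 1"
  shows "0 \<le> H2 t" "H2 t \<le> 1"
proof -
  have half: "0 \<le> H2 u \<and> H2 u \<le> 1" if "0 \<le> u" "u \<le> 1/2" for u
    using H2_mono[of 0 u] H2_mono[of u "1/2"] that by simp
  have "0 \<le> H2 t \<and> H2 t \<le> 1"
  proof (cases "t \<le> 1/2")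
    case False
    then show ?thesis
      using half[of "1 - t"] assms by (simp add: H2_symmetric)
  qed (use half assms in auto)
  then show "0 \<le> H2 t" "H2 t \<le> 1"
    by auto
qed

lemma isCont_H2:
  assumes "0 < t" "t < 1"
  shows "isCont H2 t"
  using DERIV_H2[OF assms] by (rule DERIV_isCont)

text \<open>The inner map \<open>(1 - sqrt (1 - q)) / 2\<close> increases and stays in [0, 1/2],
  where \<open>H2\<close> increases.\<close>

lemma g_mono:
  assumes "0 \<le> p" "p \<le> q" "q \<le> 1"
  shows "g p \<le> g q"
  unfolding g_def using assms by (intro H2_mono) (auto simp: field_simps)

section \<open>The univariate objective\<close>

text \<open>Ties \<open>F\<close> to the spectral boundary: when
  \<open>E^2 = (1 + \<tau>) * (s - \<tau>)\<close>, both sides are \<open>1 - E^2\<close>, the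
  argument at which \<open>g\<close> returns \<open>H2 z\<close>.\<close>

lemma one_minus_shift:
  fixes s \<delta> \<tau> :: real
  assumes "s = 1 - 2 * \<delta>"
  shows "\<tau>\<^sup>2 + 2 * \<delta> * \<tau> + 2 * \<delta> = 1 - (1 + \<tau>) * (s - \<tau>)"
  unfolding assms by (simp add: algebra_simps power2_eq_square)

text \<open>Serves twice: the minimum exists, and a bound on the open interval of \<tau> extends to
  its ends.\<close>

lemma continuous_on_F:
  assumes "0 < \<delta>" "\<delta> < 1/2"
  shows "continuous_on {0..1 - 2 * \<delta>} (F \<delta>)"
proof -
  have g: "continuous_on {0..1} g"
    unfolding g_def[abs_def]
  proof (rule continuous_on_compose2[OF continuous_on_H2])
    show "(\<lambda>q. (1 - sqrt (1 - q)) / 2) ` {0..1} \<subseteq> {0..1}"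
    proof clarify
      fix q :: real assume "q \<in> {0..1}"
      then have "0 \<le> sqrt (1 - q)" "sqrt (1 - q) \<le> 1"
        by simp_all
      then show "(1 - sqrt (1 - q)) / 2 \<in> {0..1}"
        by (simp, linarith)
    qed
  qed (intro continuous_intros; simp)
  have "continuous_on {0..1 - 2 * \<delta>} (\<lambda>\<tau>. g (\<tau>\<^sup>2))"
    using assms by (intro continuous_on_compose2[OF g]) (auto intro!: continuous_intros power_le_one)
  moreover have "continuous_on {0..1 - 2 * \<delta>} (\<lambda>\<tau>. g (\<tau>\<^sup>2 + 2 * \<delta> * \<tau> + 2 * \<delta>))"
  proof (rule continuous_on_compose2[OF g])
    show "(\<lambda>\<tau>. \<tau>\<^sup>2 + 2 * \<delta> * \<tau> + 2 * \<delta>) ` {0..1 - 2 * \<delta>} \<subseteq> {0..1}"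
    proof clarify
      fix \<tau> assume \<tau>: "\<tau> \<in> {0..1 - 2 * \<delta>}"
      then have "0 \<le> (1 + \<tau>) * (1 - 2 * \<delta> - \<tau>)" "0 \<le> \<tau>\<^sup>2 + 2 * \<delta> * \<tau> + 2 * \<delta>"
        using assms by auto
      then show "\<tau>\<^sup>2 + 2 * \<delta> * \<tau> + 2 * \<delta> \<in> {0..1}"
        using one_minus_shift[OF refl, of \<tau> \<delta>] by auto
    qed
  qed (auto intro!: continuous_intros)
  ultimately show ?thesis
    unfolding F_def[abs_def] by (intro continuous_intros)
qed

text \<open>Compactness supplies a smallest value, which is what gives the \<open>LEAST\<close> in
  \<open>M2\<close> its meaning.\<close>

lemma M2_attained:
  assumes "0 < \<delta>" "\<delta> < 1/2"
  obtains \<tau> where "\<tau> \<in> {0..1 - 2 * \<delta>}" "M2 \<delta> = F \<delta> \<tau>"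
    "\<And>\<sigma>. \<sigma> \<in> {0..1 - 2 * \<delta>} \<Longrightarrow> M2 \<delta> \<le> F \<delta> \<sigma>"
proof -
  obtain \<tau> where \<tau>: "\<tau> \<in> {0..1 - 2 * \<delta>}" "\<And>\<sigma>. \<sigma> \<in> {0..1 - 2 * \<delta>} \<Longrightarrow> F \<delta> \<tau> \<le> F \<delta> \<sigma>"
    using continuous_attains_inf[OF compact_Icc _ continuous_on_F[OF assms]] assms by auto
  have "M2 \<delta> = F \<delta> \<tau>"
    unfolding M2_def using \<tau> by (intro Least_equality) auto
  with \<tau> that show ?thesis
    by simp
qed

text \<open>The factor \<open>s - \<tau>\<close> vanishes, so the second \<open>g\<close> is
  \<open>g 1 = 1\<close> and cancels the leading 1.\<close>

lemma F_right_endpoint: "F \<delta> (1 - 2 * \<delta>) = g ((1 - 2 * \<delta>)\<^sup>2)"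
  unfolding F_def one_minus_shift[OF refl] by (simp add: g_def)

section \<open>Perturbing to the open spectral region\<close>

text \<open>Isolates the dependence on z, which enters through \<open>P_HC\<close> alone; the sign
  of the slope in \<open>P_HC\<close> then decides monotonicity.\<close>

lemma Gamma_HC_affine:
  "Gamma_HC x \<eta> \<rho> z = 2 * sqrt (x * (1 - x)) *
     (sqrt (\<rho> * (1 - \<eta>)) + sqrt (\<eta> * (1 - \<rho>)) +
      P_HC x \<eta> \<rho> z * (sqrt ((1 - \<eta>) * (1 - \<rho>)) + sqrt (\<eta> * \<rho>) -
        (sqrt (\<rho> * (1 - \<eta>)) + sqrt (\<eta> * (1 - \<rho>)))))"
  unfolding Gamma_HC_def by (simp add: algebra_simps)

text \<open>Lowering z raises E, hence \<open>P_HC\<close>, and the last hypothesis says that the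
  slope in \<open>P_HC\<close> is positive. The bound \<open>z \<le> 1/2\<close> keeps E
  nonnegative, so squaring preserves the order.\<close>

lemma Gamma_HC_strict_antimono:
  assumes "0 < x" "x < 1" "\<eta> < 1/2" "\<rho> < 1/2" "z' < z" "z \<le> 1/2"
    and "sqrt (\<rho> * (1 - \<eta>)) + sqrt (\<eta> * (1 - \<rho>)) < sqrt ((1 - \<eta>) * (1 - \<rho>)) + sqrt (\<eta> * \<rho>)"
  shows "Gamma_HC x \<eta> \<rho> z < Gamma_HC x \<eta> \<rho> z'"
proof -
  have "0 < 4 * A_HC x \<eta> * B_HC x \<rho>"
    using assms by (simp add: A_HC_def B_HC_def)
  moreover have "(E_HC z)\<^sup>2 < (E_HC z')\<^sup>2"
    using assms by (intro power_strict_mono) (auto simp: E_HC_def)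
  ultimately have "P_HC x \<eta> \<rho> z < P_HC x \<eta> \<rho> z'"
    unfolding P_HC_def by (intro divide_strict_right_mono) auto
  moreover have "0 < x * (1 - x)"
    using assms by simp
  ultimately show ?thesis
    unfolding Gamma_HC_affine using assms(7) by simp
qed

text \<open>A crude bound, wanted only so that \<open>Inf\<close> is taken over a set bounded
  below.\<close>

lemma Phi_HC_ge:
  assumes "(x, \<eta>, \<rho>, z) \<in> D_HC"
  shows "-1 \<le> Phi_HC x \<eta> \<rho> z"
proof -
  have "0 \<le> H2 x" "0 \<le> H2 \<eta>" "0 \<le> H2 \<rho>" "H2 z \<le> 1"
    using assms by (auto simp: D_HC_def intro!: H2_bounds)
  moreover have "0 \<le> (1 - x) * H2 \<eta>" "0 \<le> x * H2 \<rho>"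
    using calculation assms by (auto simp: D_HC_def)
  ultimately show ?thesis
    unfolding Phi_HC_def by linarith
qed

text \<open>A boundary point fails the strict inequality, but slightly smaller z satisfy it; their
  values bound \<open>Inf S\<close> from above and converge by continuity of \<open>H2\<close> at z.
  The set \<open>S\<close> is left open to serve both the slice and \<open>kappa_HC\<close>.\<close>

lemma Inf_le_spectral_boundary:
  assumes D: "(x, \<eta>, \<rho>, z) \<in> D_HC" and "0 < z" and "E_HC z < A_HC x \<eta> + B_HC x \<rho>"
    and "sqrt (\<rho> * (1 - \<eta>)) + sqrt (\<eta> * (1 - \<rho>)) < sqrt ((1 - \<eta>) * (1 - \<rho>)) + sqrt (\<eta> * \<rho>)"
    and bdd: "bdd_below S"
    and mem: "\<And>z'. (x, \<eta>, \<rho>, z') \<in> D_HC \<Longrightarrow> Gamma_HC x \<eta> \<rho> z < Gamma_HC x \<eta> \<rho> z' \<Longrightarrow>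
      Phi_HC x \<eta> \<rho> z' \<in> S"
  shows "Inf S \<le> Phi_HC x \<eta> \<rho> z"
proof -
  have D': "0 < x" "x \<le> 1/2" "0 \<le> \<eta>" "\<eta> < 1/2" "0 \<le> \<rho>" "\<rho> < 1/2" "z \<le> 1/2"
      "\<bar>A_HC x \<eta> - B_HC x \<rho>\<bar> \<le> E_HC z"
    using D by (auto simp: D_HC_def)
  have "isCont H2 z"
    using assms D' by (intro isCont_H2) auto
  then have "((\<lambda>z. Phi_HC x \<eta> \<rho> z) \<longlongrightarrow> Phi_HC x \<eta> \<rho> z) (at_left z)"
    by (simp add: Phi_HC_def[abs_def] isCont_def filterlim_at_split tendsto_diff)
  moreover have "\<forall>\<^sub>F z' in at_left z. Inf S \<le> Phi_HC x \<eta> \<rho> z'"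
  proof -
    \<comment> \<open>Above this threshold both \<open>0 \<le> z'\<close> and
      \<open>E_HC z' \<le> A + B\<close> survive; the lower bound on \<open>E_HC\<close> only
      improves as z decreases.\<close>
    define a where "a = max 0 ((1 - (A_HC x \<eta> + B_HC x \<rho>)) / 2)"
    have "a < z"
      using assms by (auto simp: a_def E_HC_def)
    then have "\<forall>\<^sub>F z' in at_left z. z' \<in> {a<..<z}"
      by (rule eventually_at_left_real)
    then show ?thesis
    proof eventually_elim
      case (elim z')
      have "(x, \<eta>, \<rho>, z') \<in> D_HC"
        using D' elim by (auto simp: D_HC_def E_HC_def a_def)
      moreover have "Gamma_HC x \<eta> \<rho> z < Gamma_HC x \<eta> \<rho> z'"
        using D' elim assms by (intro Gamma_HC_strict_antimono) auto
      ultimately show ?case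
        using bdd mem by (intro cInf_lower) auto
    qed
  qed
  ultimately show ?thesis
    by (intro tendsto_lowerbound) auto
qed

section \<open>The symmetric slice\<close>

lemma A_HC_half: "A_HC (1/2) \<eta> = (1 - 2 * \<eta>) / 2"
  by (simp add: A_HC_def)

lemma B_HC_half: "B_HC (1/2) \<eta> = (1 - 2 * \<eta>) / 2"
  by (simp add: B_HC_def)

text \<open>With \<eta> = sin^2(t/2) one has \<tau> = sin t and 1 - 2\<eta> = cos t > 0, so this is
  the Pythagorean identity without the angle.\<close>

lemma one_minus_sin_sq:
  fixes \<eta> :: real
  assumes "0 \<le> \<eta>" "\<eta> < 1/2" "\<tau> = 2 * sqrt (\<eta> * (1 - \<eta>))"
  shows "(1 - 2 * \<eta>)\<^sup>2 = 1 - \<tau>\<^sup>2" "0 \<le> \<tau>" "\<tau> < 1"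
proof -
  have "\<tau>\<^sup>2 = 4 * (\<eta> * (1 - \<eta>))"
    using assms by (simp add: power_mult_distrib)
  then show eq: "(1 - 2 * \<eta>)\<^sup>2 = 1 - \<tau>\<^sup>2"
    by (simp add: power2_eq_square algebra_simps)
  show "0 \<le> \<tau>"
    using assms by simp
  have "0 < (1 - 2 * \<eta>)\<^sup>2"
    using assms by simp
  then have "\<tau>\<^sup>2 < 1\<^sup>2"
    using eq by simp
  then show "\<tau> < 1"
    by (rule power2_less_imp_less) simp
qed

lemma P_HC_symmetric:
  assumes "0 \<le> \<eta>" "\<eta> < 1/2" "\<tau> = 2 * sqrt (\<eta> * (1 - \<eta>))"
  shows "P_HC (1/2) \<eta> \<eta> z = (E_HC z)\<^sup>2 / (1 - \<tau>\<^sup>2)"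
proof -
  have "4 * ((1 - 2 * \<eta>) / 2) * ((1 - 2 * \<eta>) / 2) = (1 - 2 * \<eta>)\<^sup>2"
    by (simp add: power2_eq_square)
  then show ?thesis
    unfolding P_HC_def A_HC_half B_HC_half one_minus_sin_sq(1)[OF assms, symmetric] by simp
qed

lemma Gamma_HC_symmetric:
  assumes "0 \<le> \<eta>" "\<eta> < 1/2" "\<tau> = 2 * sqrt (\<eta> * (1 - \<eta>))"
  shows "Gamma_HC (1/2) \<eta> \<eta> z = \<tau> + P_HC (1/2) \<eta> \<eta> z * (1 - \<tau>)"
proof -
  have half: "sqrt (1/2 * (1 - 1/2)) = (1/2 :: real)"
    by (rule real_sqrt_unique) (auto simp: power2_eq_square)
  have roots: "sqrt ((1 - \<eta>) * (1 - \<eta>)) = 1 - \<eta>" "sqrt (\<eta> * \<eta>) = \<eta>" "sqrt (\<eta> * (1 - \<eta>)) = \<tau> / 2"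
    using assms by simp_all
  show ?thesis
    unfolding Gamma_HC_affine half roots by simp
qed

text \<open>Factoring \<open>1 - \<tau>\<^sup>2\<close> cancels the slope \<open>1 - \<tau>\<close>
  of \<Gamma> in \<open>P_HC\<close>, leaving \<open>E^2 / (1 + \<tau>)\<close>.\<close>

lemma symmetric_boundary_iff:
  assumes "0 \<le> \<eta>" "\<eta> < 1/2" "\<tau> = 2 * sqrt (\<eta> * (1 - \<eta>))"
  shows "Gamma_HC (1/2) \<eta> \<eta> z = s \<longleftrightarrow> P_HC (1/2) \<eta> \<eta> z = (s - \<tau>) / (1 - \<tau>)"
    and "Gamma_HC (1/2) \<eta> \<eta> z = s \<longleftrightarrow> (E_HC z)\<^sup>2 = (1 + \<tau>) * (s - \<tau>)"
    and "s < Gamma_HC (1/2) \<eta> \<eta> z \<longleftrightarrow> (1 + \<tau>) * (s - \<tau>) < (E_HC z)\<^sup>2"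
proof -
  note \<tau> = one_minus_sin_sq[OF assms]
  have eq: "1 - \<tau>\<^sup>2 = (1 + \<tau>) * (1 - \<tau>)"
    by (simp add: power2_eq_square algebra_simps)
  have \<Gamma>: "Gamma_HC (1/2) \<eta> \<eta> z = \<tau> + (E_HC z)\<^sup>2 / (1 + \<tau>)"
    unfolding Gamma_HC_symmetric[OF assms] P_HC_symmetric[OF assms] eq using \<tau> by simp
  show "Gamma_HC (1/2) \<eta> \<eta> z = s \<longleftrightarrow> P_HC (1/2) \<eta> \<eta> z = (s - \<tau>) / (1 - \<tau>)"
    unfolding Gamma_HC_symmetric[OF assms] using \<tau> by (auto simp: field_simps)
  show "Gamma_HC (1/2) \<eta> \<eta> z = s \<longleftrightarrow> (E_HC z)\<^sup>2 = (1 + \<tau>) * (s - \<tau>)"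
    unfolding \<Gamma> using \<tau> by (auto simp: field_simps)
  show "s < Gamma_HC (1/2) \<eta> \<eta> z \<longleftrightarrow> (1 + \<tau>) * (s - \<tau>) < (E_HC z)\<^sup>2"
    unfolding \<Gamma> using \<tau> by (auto simp: field_simps)
qed

text \<open>Here \<open>sqrt (1 - \<tau>\<^sup>2)\<close> is \<open>1 - 2 * \<eta>\<close>, with the
  sign fixed by \<eta> < 1/2, so the inner map of \<open>g\<close> returns \<eta>.\<close>

lemma g_sin_sq:
  assumes "0 \<le> \<eta>" "\<eta> < 1/2" "\<tau> = 2 * sqrt (\<eta> * (1 - \<eta>))"
  shows "g (\<tau>\<^sup>2) = H2 \<eta>"
  unfolding g_def one_minus_sin_sq(1)[OF assms, symmetric] using assms by simp

lemma H2_eq_g: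
  assumes "z \<le> 1/2"
  shows "H2 z = g (1 - (E_HC z)\<^sup>2)"
  unfolding g_def E_HC_def using assms by simp

lemma Phi_HC_symmetric: "Phi_HC (1/2) \<eta> \<eta> z = 1 + H2 \<eta> - H2 z"
  unfolding Phi_HC_def by simp

lemma Phi_HC_symmetric_boundary:
  assumes "0 \<le> \<eta>" "\<eta> < 1/2" "\<tau> = 2 * sqrt (\<eta> * (1 - \<eta>))" "z \<le> 1/2"
    and "(E_HC z)\<^sup>2 = (1 + \<tau>) * (1 - 2 * \<delta> - \<tau>)"
  shows "Phi_HC (1/2) \<eta> \<eta> z = F \<delta> \<tau>"
  unfolding Phi_HC_symmetric F_def one_minus_shift[OF refl] assms(5)[symmetric]
  using g_sin_sq[OF assms(1-3)] H2_eq_g[OF assms(4)] by simp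

lemma M2_le_Phi_HC_symmetric:
  assumes "0 < \<delta>" "\<delta> < 1/2" and D: "(1/2, \<eta>, \<eta>, z) \<in> D_HC"
    and \<Gamma>: "1 - 2 * \<delta> < Gamma_HC (1/2) \<eta> \<eta> z"
  shows "M2 \<delta> \<le> Phi_HC (1/2) \<eta> \<eta> z"
proof -
  have \<eta>: "0 \<le> \<eta>" "\<eta> < 1/2" and z: "0 \<le> z" "z \<le> 1/2"
    using D by (auto simp: D_HC_def)
  define \<tau> where "\<tau> = 2 * sqrt (\<eta> * (1 - \<eta>))"
  note \<tau> = one_minus_sin_sq[OF \<eta> \<tau>_def]
  have M2: "M2 \<delta> \<le> F \<delta> \<sigma>" if "\<sigma> \<in> {0..1 - 2 * \<delta>}" for \<sigma>
    using M2_attained[OF assms(1,2)] that by metis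
  show ?thesis
  proof (cases "\<tau> \<le> 1 - 2 * \<delta>")
    case True
    \<comment> \<open>The next three facts place both arguments of \<open>g\<close> in [0, 1], in
      the order that \<open>g_mono\<close> needs.\<close>
    have "0 \<le> (1 + \<tau>) * (1 - 2 * \<delta> - \<tau>)"
      using True \<tau> by simp
    moreover have "(1 + \<tau>) * (1 - 2 * \<delta> - \<tau>) < (E_HC z)\<^sup>2"
      using \<Gamma> symmetric_boundary_iff(3)[OF \<eta> \<tau>_def] by simp
    moreover have "(E_HC z)\<^sup>2 \<le> 1"
      using z by (intro power_le_one) (auto simp: E_HC_def)
    ultimately have "g (1 - (E_HC z)\<^sup>2) \<le> g (1 - (1 + \<tau>) * (1 - 2 * \<delta> - \<tau>))"
      by (intro g_mono) auto
    then have "F \<delta> \<tau> \<le> Phi_HC (1/2) \<eta> \<eta> z"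
      unfolding Phi_HC_symmetric F_def one_minus_shift[OF refl] H2_eq_g[OF z(2)] g_sin_sq[OF \<eta> \<tau>_def]
      by simp
    then show ?thesis
      using M2[of \<tau>] True \<tau> by simp
  next
    case False
    \<comment> \<open>Now \<tau> lies outside the domain of the minimum, so the comparison is with
      the right endpoint: \<Phi> \<ge> \<open>H2 \<eta>\<close> = \<open>g (\<tau>\<^sup>2)\<close>
      \<ge> \<open>F \<delta> s\<close>, since \<open>H2 z \<le> 1\<close>.\<close>
    then have "(1 - 2 * \<delta>)\<^sup>2 \<le> \<tau>\<^sup>2" "\<tau>\<^sup>2 \<le> 1"
      using assms \<tau> by (auto intro!: power_mono power_le_one)
    then have "g ((1 - 2 * \<delta>)\<^sup>2) \<le> g (\<tau>\<^sup>2)"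
      by (intro g_mono) auto
    moreover have "H2 z \<le> 1"
      using z by (intro H2_bounds) auto
    ultimately show ?thesis
      using M2[of "1 - 2 * \<delta>"] assms
      by (simp add: F_right_endpoint Phi_HC_symmetric g_sin_sq[OF \<eta> \<tau>_def])
  qed
qed

section \<open>The balanced family\<close>

lemma one_minus_2_sin_sq: "1 - 2 * (sin u)\<^sup>2 = cos (2 * u)" for u :: real
  by (simp add: cos_double_sin)

lemma A_HC_bal: "A_HC x (eta_bal x t) = A_bal x t"
  unfolding A_HC_def eta_bal_def A_bal_def one_minus_2_sin_sq mult.assoc ..

lemma B_HC_bal: "B_HC x (rho_bal x t) = B_bal x t"
  unfolding B_HC_def rho_bal_def B_bal_def one_minus_2_sin_sq mult.assoc ..

lemma E_HC_bal: "E_HC (z_bal x t \<delta>) = E_bal x t \<delta>"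
  by (simp add: E_HC_def z_bal_def field_simps)

lemma Phi_bal_eq: "Phi_bal x t \<delta> = Phi_HC x (eta_bal x t) (rho_bal x t) (z_bal x t \<delta>)"
  by (simp add: Phi_bal_def Phi_HC_def)

locale balanced_point =
  fixes x t :: real
  assumes x: "0 < x" "x \<le> 1/2" and t: "0 \<le> t" "t < pi / (4 * (1 - x))"
begin

text \<open>The range of t is exactly what keeps the larger angle below pi/4, so both doubled angles
  have positive cosine.\<close>

lemma angle_bounds: "0 \<le> x * t" "x * t \<le> (1 - x) * t" "(1 - x) * t < pi / 4" "0 \<le> (1 - x) * t"
proof -
  show "0 \<le> x * t" "0 \<le> (1 - x) * t"
    using x t by auto
  show "x * t \<le> (1 - x) * t"
    using x t by (intro mult_right_mono) auto
  show "(1 - x) * t < pi / 4"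
    using x t by (simp add: field_simps)
qed

lemma sin_cos_nonneg:
  "0 \<le> sin (x * t)" "0 \<le> sin ((1 - x) * t)" "0 \<le> cos (x * t)" "0 \<le> cos ((1 - x) * t)"
  using angle_bounds by (auto intro!: sin_ge_zero cos_ge_zero)

lemma AB_bal_pos: "0 < A_bal x t" "0 < B_bal x t"
proof -
  have "0 < cos (2 * (x * t))" "0 < cos (2 * ((1 - x) * t))"
    using angle_bounds pi_gt_zero by (intro cos_gt_zero_pi; linarith)+
  then show "0 < A_bal x t" "0 < B_bal x t"
    unfolding A_bal_def B_bal_def mult.assoc using x by simp_all
qed

lemma eta_rho_bal_bounds: "0 \<le> eta_bal x t" "eta_bal x t < 1/2" "0 \<le> rho_bal x t" "rho_bal x t < 1/2"
proof -
  have "0 < (1 - x) * (1 - 2 * eta_bal x t)" "0 < x * (1 - 2 * rho_bal x t)"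
    using AB_bal_pos by (simp_all flip: A_HC_bal B_HC_bal add: A_HC_def B_HC_def)
  then have "0 < 1 - 2 * eta_bal x t" "0 < 1 - 2 * rho_bal x t"
    using x by (auto dest: zero_less_mult_pos)
  then show "eta_bal x t < 1/2" "rho_bal x t < 1/2"
    by auto
qed (simp_all add: eta_bal_def rho_bal_def)

text \<open>The angles \<open>x * t\<close> and \<open>(1 - x) * t\<close> have sum t and difference
  \<open>(1 - 2 * x) * t\<close>; with nonnegative sines and cosines the roots open up to the
  addition formulas.\<close>

lemma sqrt_bal:
  "sqrt ((1 - eta_bal x t) * (1 - rho_bal x t)) + sqrt (eta_bal x t * rho_bal x t) = cos ((1 - 2 * x) * t)"
  "sqrt (rho_bal x t * (1 - eta_bal x t)) + sqrt (eta_bal x t * (1 - rho_bal x t)) = sin t"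
proof -
  have c: "1 - eta_bal x t = (cos (x * t))\<^sup>2" "1 - rho_bal x t = (cos ((1 - x) * t))\<^sup>2"
    by (simp_all add: eta_bal_def rho_bal_def cos_squared_eq)
  have e: "(1 - 2 * x) * t = (1 - x) * t - x * t"
    by (simp add: algebra_simps)
  show "sqrt ((1 - eta_bal x t) * (1 - rho_bal x t)) + sqrt (eta_bal x t * rho_bal x t) = cos ((1 - 2 * x) * t)"
    unfolding c unfolding e cos_diff eta_bal_def rho_bal_def using sin_cos_nonneg
    by (simp add: real_sqrt_mult)
  have e': "sin t = sin ((1 - x) * t + x * t)"
    by (simp add: algebra_simps)
  show "sqrt (rho_bal x t * (1 - eta_bal x t)) + sqrt (eta_bal x t * (1 - rho_bal x t)) = sin t"
    unfolding c unfolding e' sin_add eta_bal_def rho_bal_def using sin_cos_nonneg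
    by (simp add: real_sqrt_mult)
qed

text \<open>Writing sin t as cos(pi/2 - t), this is monotonicity of the cosine together with
  \<open>(1 - x) * t < pi / 4\<close>. It makes the slope of \<Gamma> positive.\<close>

lemma sin_less_cos: "sin t < cos ((1 - 2 * x) * t)"
proof -
  have "(1 - 2 * x) * t < pi / 2 - t"
    using angle_bounds(3) by (simp add: algebra_simps)
  moreover have "0 \<le> (1 - 2 * x) * t"
    using x t by simp
  ultimately have "cos (pi / 2 - t) < cos ((1 - 2 * x) * t)"
    using t pi_gt_zero by (intro cos_monotone_0_pi) linarith+
  then show ?thesis
    by (simp add: cos_diff)
qed

lemma S_minus_less_S_plus: "S_minus x t < S_plus x t"
  unfolding S_minus_def S_plus_def using sin_less_cos x by simp

lemma E_bal_sq:
  assumes "0 \<le> P_bal x t \<delta>"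
  shows "(E_bal x t \<delta>)\<^sup>2 = (A_bal x t - B_bal x t)\<^sup>2 + 4 * A_bal x t * B_bal x t * P_bal x t \<delta>"
  unfolding E_bal_def using assms AB_bal_pos by simp

lemma P_HC_bal:
  assumes "0 \<le> P_bal x t \<delta>"
  shows "P_HC x (eta_bal x t) (rho_bal x t) (z_bal x t \<delta>) = P_bal x t \<delta>"
  unfolding P_HC_def A_HC_bal B_HC_bal E_HC_bal E_bal_sq[OF assms] using AB_bal_pos by simp

text \<open>\<open>E_bal\<close> inverts the formula for \<open>P_HC\<close>, and
  \<open>P_bal\<close> solves the resulting affine equation \<Gamma> = s.\<close>

lemma Gamma_HC_bal:
  assumes "0 \<le> P_bal x t \<delta>"
  shows "Gamma_HC x (eta_bal x t) (rho_bal x t) (z_bal x t \<delta>) = 1 - 2 * \<delta>"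
proof -
  have "Gamma_HC x (eta_bal x t) (rho_bal x t) (z_bal x t \<delta>) =
      2 * (S_minus x t + P_bal x t \<delta> * (S_plus x t - S_minus x t))"
    unfolding Gamma_HC_affine sqrt_bal P_HC_bal[OF assms] S_minus_def S_plus_def
    by (simp add: algebra_simps)
  also have "\<dots> = 1 - 2 * \<delta>"
    unfolding P_bal_def using S_minus_less_S_plus by simp
  finally show ?thesis .
qed

text \<open>\<open>E_bal\<close> squared is strictly increasing in P and would reach (A + B)^2 at P
  = 1.\<close>

lemma E_bal_less:
  assumes "0 \<le> P_bal x t \<delta>" "P_bal x t \<delta> < 1"
  shows "E_bal x t \<delta> < A_bal x t + B_bal x t"
proof (rule power2_less_imp_less)
  have "4 * A_bal x t * B_bal x t * P_bal x t \<delta> < 4 * A_bal x t * B_bal x t * 1"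
    using assms AB_bal_pos by (intro mult_strict_left_mono) auto
  then show "(E_bal x t \<delta>)\<^sup>2 < (A_bal x t + B_bal x t)\<^sup>2"
    unfolding E_bal_sq[OF assms(1)] by (simp add: power2_eq_square algebra_simps)
qed (use AB_bal_pos in auto)

lemma bal_in_D_HC:
  assumes "0 \<le> P_bal x t \<delta>" "P_bal x t \<delta> < 1" "E_bal x t \<delta> < 1"
  shows "(x, eta_bal x t, rho_bal x t, z_bal x t \<delta>) \<in> D_HC"
proof -
  have "\<bar>A_bal x t - B_bal x t\<bar> \<le> E_bal x t \<delta>"
    unfolding E_bal_def using assms AB_bal_pos by (intro real_le_rsqrt) simp
  moreover have "0 \<le> E_bal x t \<delta>"
    using calculation by linarith
  ultimately show ?thesis
    using assms x eta_rho_bal_bounds E_bal_less[OF assms(1,2)]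
    by (simp add: D_HC_def A_HC_bal B_HC_bal E_HC_bal) (simp add: z_bal_def)
qed

text \<open>\<open>E_bal < 1\<close> gives z > 0 and \<open>P_bal < 1\<close> gives E < A + B, the
  room needed to lower z. P = 0 is allowed, which covers \<tau> = s on the slice.\<close>

lemma Inf_le_Phi_bal:
  assumes "0 \<le> P_bal x t \<delta>" "P_bal x t \<delta> < 1" "E_bal x t \<delta> < 1" "bdd_below S"
    and "\<And>z. (x, eta_bal x t, rho_bal x t, z) \<in> D_HC \<Longrightarrow>
      1 - 2 * \<delta> < Gamma_HC x (eta_bal x t) (rho_bal x t) z \<Longrightarrow>
      Phi_HC x (eta_bal x t) (rho_bal x t) z \<in> S"
  shows "Inf S \<le> Phi_bal x t \<delta>"
  unfolding Phi_bal_eq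
proof (rule Inf_le_spectral_boundary)
  show "(x, eta_bal x t, rho_bal x t, z_bal x t \<delta>) \<in> D_HC"
    using assms by (intro bal_in_D_HC) auto
  show "0 < z_bal x t \<delta>"
    using assms by (simp add: z_bal_def)
  show "E_HC (z_bal x t \<delta>) < A_HC x (eta_bal x t) + B_HC x (rho_bal x t)"
    using assms E_bal_less by (simp add: A_HC_bal B_HC_bal E_HC_bal)
qed (use assms sin_less_cos in \<open>auto simp: sqrt_bal Gamma_HC_bal\<close>)

end

lemma eta_bal_half: "eta_bal (1/2) t = (sin (t / 2))\<^sup>2" "rho_bal (1/2) t = (sin (t / 2))\<^sup>2"
  by (simp_all add: eta_bal_def rho_bal_def)

locale symmetric_balanced_point =
  fixes t \<tau> \<delta> :: real
  assumes \<delta>: "0 < \<delta>" "\<delta> < 1/2" and t: "0 \<le> t" "t < pi / 2"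
    and \<tau>_eq: "\<tau> = sin t" and \<tau>_le: "\<tau> \<le> 1 - 2 * \<delta>"
begin

sublocale balanced_point "1/2" t
  by unfold_locales (use t in auto)

lemma \<tau>_nonneg: "0 \<le> \<tau>"
  using t by (auto simp: \<tau>_eq intro!: sin_ge_zero)

lemma \<tau>_less: "\<tau> < 1"
  using \<delta> \<tau>_le by simp

lemma eta_bal_half_sin: "\<tau> = 2 * sqrt (eta_bal (1/2) t * (1 - eta_bal (1/2) t))"
  using sqrt_bal(2) by (simp add: \<tau>_eq eta_bal_half)

lemma P_bal_half: "P_bal (1/2) t \<delta> = (1 - 2 * \<delta> - \<tau>) / (1 - \<tau>)"
proof -
  have "sqrt (1/2 * (1 - 1/2)) = (1/2 :: real)"
    by (rule real_sqrt_unique) (auto simp: power2_eq_square)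
  then show ?thesis
    unfolding P_bal_def S_minus_def S_plus_def \<tau>_eq[symmetric] using \<tau>_less
    by (simp add: field_simps)
qed

lemma P_bal_half_bounds: "0 \<le> P_bal (1/2) t \<delta>" "P_bal (1/2) t \<delta> < 1"
  unfolding P_bal_half using \<tau>_less \<tau>_le \<delta> by auto

text \<open>Read off from \<Gamma> = s through the slice equivalence instead of unfolding
  \<open>E_bal\<close>.\<close>

lemma E_bal_half_sq: "(E_bal (1/2) t \<delta>)\<^sup>2 = (1 + \<tau>) * (1 - 2 * \<delta> - \<tau>)"
  using Gamma_HC_bal[OF P_bal_half_bounds(1)] eta_rho_bal_bounds
    symmetric_boundary_iff(2)[OF _ _ eta_bal_half_sin, of "z_bal (1/2) t \<delta>" "1 - 2 * \<delta>"]
  by (simp add: eta_bal_half E_HC_bal)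

lemma E_bal_half_bounds: "0 \<le> E_bal (1/2) t \<delta>" "E_bal (1/2) t \<delta> < 1"
proof -
  show "0 \<le> E_bal (1/2) t \<delta>"
    unfolding E_bal_def using P_bal_half_bounds AB_bal_pos by simp
  \<comment> \<open>This makes 1 - E^2 at least 2\<delta> > 0.\<close>
  have "0 \<le> \<tau>\<^sup>2 + 2 * \<delta> * \<tau>"
    using \<delta> \<tau>_nonneg by simp
  then have "(E_bal (1/2) t \<delta>)\<^sup>2 < 1\<^sup>2"
    using one_minus_shift[OF refl, of \<tau> \<delta>] \<delta> unfolding E_bal_half_sq by simp
  then show "E_bal (1/2) t \<delta> < 1"
    by (rule power2_less_imp_less) simp
qed

lemma Phi_bal_half: "Phi_bal (1/2) t \<delta> = F \<delta> \<tau>"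
proof -
  have "z_bal (1/2) t \<delta> \<le> 1/2"
    using E_bal_half_bounds by (simp add: z_bal_def)
  then show ?thesis
    using Phi_HC_symmetric_boundary[OF _ _ eta_bal_half_sin, of "z_bal (1/2) t \<delta>" \<delta>] eta_rho_bal_bounds
    by (simp add: Phi_bal_eq eta_bal_half E_HC_bal E_bal_half_sq)
qed

end

lemma symmetric_balanced_point_arcsin:
  assumes "0 < \<delta>" "\<delta> < 1/2" "0 \<le> \<tau>" "\<tau> \<le> 1 - 2 * \<delta>"
  shows "symmetric_balanced_point (arcsin \<tau>) \<tau> \<delta>"
proof
  have "arcsin \<tau> < arcsin 1"
    using assms by (intro arcsin_less_arcsin) auto
  then show "arcsin \<tau> < pi / 2"
    by simp
  have "arcsin 0 \<le> arcsin \<tau>"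
    using assms by (intro arcsin_le_arcsin) auto
  then show "0 \<le> arcsin \<tau>"
    by simp
qed (use assms in auto)

section \<open>The infima\<close>

lemma Inf_symmetric_slice:
  assumes "0 < \<delta>" "\<delta> < 1/2"
  shows "Inf {Phi_HC x \<eta> \<rho> z | x \<eta> \<rho> z.
    (x, \<eta>, \<rho>, z) \<in> D_HC \<and> x = 1/2 \<and> \<eta> = \<rho> \<and> Gamma_HC x \<eta> \<rho> z > 1 - 2 * \<delta>} = M2 \<delta>"
    (is "Inf ?S = _")
proof -
  have lower: "M2 \<delta> \<le> y" if "y \<in> ?S" for y
  proof -
    obtain \<eta> z where "y = Phi_HC (1/2) \<eta> \<eta> z" "(1/2, \<eta>, \<eta>, z) \<in> D_HC"
        "1 - 2 * \<delta> < Gamma_HC (1/2) \<eta> \<eta> z"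
      using \<open>y \<in> ?S\<close> by blast
    then show ?thesis
      using M2_le_Phi_HC_symmetric[OF assms] by simp
  qed
  then have bdd: "bdd_below ?S"
    by (rule bdd_belowI)
  \<comment> \<open>A witness of nonemptiness: \<Gamma> = 1 exceeds s because \<delta> > 0.\<close>
  have "(1/2, 0, 0, 0) \<in> D_HC" "Gamma_HC (1/2) 0 0 0 = 1"
    using Gamma_HC_symmetric[of 0 0 0] P_HC_symmetric[of 0 0 0]
    by (simp_all add: D_HC_def A_HC_def B_HC_def E_HC_def)
  then have "Phi_HC (1/2) 0 0 0 \<in> ?S"
    using assms by force
  then have "M2 \<delta> \<le> Inf ?S"
    using lower by (intro cInf_greatest) auto
  moreover have "Inf ?S \<le> M2 \<delta>"
  proof -
    obtain \<tau> where \<tau>: "\<tau> \<in> {0..1 - 2 * \<delta>}" "M2 \<delta> = F \<delta> \<tau>"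
      using M2_attained[OF assms] by metis
    then interpret symmetric_balanced_point "arcsin \<tau>" \<tau> \<delta>
      using assms by (intro symmetric_balanced_point_arcsin) auto
    \<comment> \<open>Only z is perturbed, so x = 1/2 and \<eta> = \<rho> persist and the nearby
      points stay in the slice.\<close>
    have "Inf ?S \<le> Phi_bal (1/2) (arcsin \<tau>) \<delta>"
      by (rule Inf_le_Phi_bal[OF P_bal_half_bounds E_bal_half_bounds(2) bdd])
        (unfold eta_bal_half, blast)
    then show ?thesis
      by (simp add: \<tau> Phi_bal_half)
  qed
  ultimately show ?thesis
    by simp
qed

lemma Phi_bal_ge:
  assumes "0 < x" "x \<le> 1/2" "0 < E_bal x t \<delta>" "E_bal x t \<delta> < 1"
  shows "-1 \<le> Phi_bal x t \<delta>"
proof -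
  have "0 \<le> H2 x" "0 \<le> H2 (eta_bal x t)" "0 \<le> H2 (rho_bal x t)" "H2 (z_bal x t \<delta>) \<le> 1"
    using assms by (auto simp: eta_bal_def rho_bal_def z_bal_def abs_square_le_1 intro!: H2_bounds)
  moreover have "0 \<le> (1 - x) * H2 (eta_bal x t)" "0 \<le> x * H2 (rho_bal x t)"
    using calculation assms by auto
  ultimately show ?thesis
    unfolding Phi_bal_def by linarith
qed

text \<open>The strict conditions t > 0 and P > 0 exclude \<tau> = 0 and \<tau> = s, hence the open
  range. The second claim provides nonemptiness for the infimum.\<close>

lemma kappa_bal_le_F:
  assumes "0 < \<delta>" "\<delta> < 1/2" "0 < \<tau>" "\<tau> < 1 - 2 * \<delta>"
  shows "kappa_bal \<delta> \<le> F \<delta> \<tau>"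
    and "\<exists>x t. 0 < x \<and> x \<le> 1/2 \<and> 0 < t \<and> t < pi / (4 * (1 - x)) \<and>
     0 < P_bal x t \<delta> \<and> P_bal x t \<delta> < 1 \<and> 0 < E_bal x t \<delta> \<and> E_bal x t \<delta> < 1"
proof -
  interpret symmetric_balanced_point "arcsin \<tau>" \<tau> \<delta>
    using assms by (intro symmetric_balanced_point_arcsin) auto
  have P: "0 < P_bal (1/2) (arcsin \<tau>) \<delta>"
    unfolding P_bal_half using assms \<tau>_less by simp
  have "0 < (E_bal (1/2) (arcsin \<tau>) \<delta>)\<^sup>2"
    unfolding E_bal_half_sq using assms by simp
  then have E: "0 < E_bal (1/2) (arcsin \<tau>) \<delta>"
    using E_bal_half_bounds(1) by (simp add: order_less_le)
  have "arcsin \<tau> \<noteq> 0"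
    using assms(3) \<tau>_eq by (metis less_irrefl sin_zero)
  then have "0 < arcsin \<tau>"
    using t by simp
  then have mem: "0 < (1/2::real) \<and> (1/2::real) \<le> 1/2 \<and> 0 < arcsin \<tau> \<and> arcsin \<tau> < pi / (4 * (1 - 1/2)) \<and>
     0 < P_bal (1/2) (arcsin \<tau>) \<delta> \<and> P_bal (1/2) (arcsin \<tau>) \<delta> < 1 \<and>
     0 < E_bal (1/2) (arcsin \<tau>) \<delta> \<and> E_bal (1/2) (arcsin \<tau>) \<delta> < 1"
    using P E t P_bal_half_bounds E_bal_half_bounds by simp
  then show "\<exists>x t. 0 < x \<and> x \<le> 1/2 \<and> 0 < t \<and> t < pi / (4 * (1 - x)) \<and>
     0 < P_bal x t \<delta> \<and> P_bal x t \<delta> < 1 \<and> 0 < E_bal x t \<delta> \<and> E_bal x t \<delta> < 1"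
    by blast
  have "kappa_bal \<delta> \<le> Phi_bal (1/2) (arcsin \<tau>) \<delta>"
    unfolding kappa_bal_def
  proof (rule cInf_lower)
    show "bdd_below {Phi_bal x t \<delta> | x t. 0 < x \<and> x \<le> 1/2 \<and> 0 < t \<and> t < pi / (4 * (1 - x)) \<and>
       0 < P_bal x t \<delta> \<and> P_bal x t \<delta> < 1 \<and> 0 < E_bal x t \<delta> \<and> E_bal x t \<delta> < 1}"
      by (rule bdd_belowI[of _ "-1"]) (auto intro: Phi_bal_ge)
  qed (use mem in blast)
  then show "kappa_bal \<delta> \<le> F \<delta> \<tau>"
    by (simp add: Phi_bal_half)
qed

text \<open>A minimizer at an end of the interval is not itself admissible in
  \<open>kappa_bal\<close>; continuity of \<open>F\<close> carries the bound to the closure.\<close>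

lemma kappa_bal_le_M2:
  assumes "0 < \<delta>" "\<delta> < 1/2"
  shows "kappa_bal \<delta> \<le> M2 \<delta>"
proof -
  obtain \<tau> where \<tau>: "\<tau> \<in> {0..1 - 2 * \<delta>}" "M2 \<delta> = F \<delta> \<tau>"
    using M2_attained[OF assms] by metis
  have cl: "closure {0<..<1 - 2 * \<delta>} = {0..1 - 2 * \<delta>}"
    using assms by (intro closure_greaterThanLessThan) simp
  have "continuous_on (closure {0<..<1 - 2 * \<delta>}) (F \<delta>)"
    using continuous_on_F[OF assms] by (simp add: cl)
  then have "kappa_bal \<delta> \<le> F \<delta> \<tau>"
    by (rule continuous_ge_on_closure) (use \<tau> cl assms kappa_bal_le_F(1) in auto)
  then show ?thesis
    by (simp add: \<tau>)
qed

text \<open>Every admissible balanced point lies on \<Gamma> = s and is approached from \<Gamma> > s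
  by lowering z.\<close>

lemma kappa_HC_le_kappa_bal:
  assumes "0 < \<delta>" "\<delta> < 1/2"
  shows "kappa_HC \<delta> \<le> kappa_bal \<delta>"
  unfolding kappa_bal_def
proof (rule cInf_greatest)
  show "{Phi_bal x t \<delta> | x t. 0 < x \<and> x \<le> 1/2 \<and> 0 < t \<and> t < pi / (4 * (1 - x)) \<and>
     0 < P_bal x t \<delta> \<and> P_bal x t \<delta> < 1 \<and> 0 < E_bal x t \<delta> \<and> E_bal x t \<delta> < 1} \<noteq> {}"
    \<comment> \<open>Any interior \<tau> would do; the midpoint s/2 is taken.\<close>
    using kappa_bal_le_F(2)[OF assms, of "(1 - 2 * \<delta>) / 2"] assms by auto
next
  fix y
  assume "y \<in> {Phi_bal x t \<delta> | x t. 0 < x \<and> x \<le> 1/2 \<and> 0 < t \<and> t < pi / (4 * (1 - x)) \<and>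
     0 < P_bal x t \<delta> \<and> P_bal x t \<delta> < 1 \<and> 0 < E_bal x t \<delta> \<and> E_bal x t \<delta> < 1}"
  then obtain x t where y: "y = Phi_bal x t \<delta>" and xt: "0 < x" "x \<le> 1/2" "0 < t" "t < pi / (4 * (1 - x))"
    and PE: "0 < P_bal x t \<delta>" "P_bal x t \<delta> < 1" "0 < E_bal x t \<delta>" "E_bal x t \<delta> < 1"
    by blast
  interpret balanced_point x t
    by unfold_locales (use xt in auto)
  show "kappa_HC \<delta> \<le> y"
    unfolding kappa_HC_def y
  proof (rule Inf_le_Phi_bal)
    show "bdd_below {Phi_HC x \<eta> \<rho> z | x \<eta> \<rho> z. (x, \<eta>, \<rho>, z) \<in> D_HC \<and> Gamma_HC x \<eta> \<rho> z > 1 - 2 * \<delta>}"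
      by (rule bdd_belowI[of _ "-1"]) (auto intro: Phi_HC_ge)
  qed (use PE in auto)
qed

theorem proposition5p4:
  fixes \<delta> s :: real
  assumes "0 < \<delta>" and "\<delta> < 1/2" and "s = 1 - 2 * \<delta>"
  shows
    "(\<forall>t \<tau>. 0 \<le> t \<and> t < pi / 2 \<and> \<tau> = sin t \<longrightarrow>
        eta_bal (1/2) t = (sin (t / 2))\<^sup>2 \<and> rho_bal (1/2) t = (sin (t / 2))\<^sup>2 \<and>
        (0 \<le> \<tau> \<and> \<tau> \<le> s \<longrightarrow>
           (\<forall>z. (1/2, eta_bal (1/2) t, rho_bal (1/2) t, z) \<in> D_HC \<longrightarrow>
              (Gamma_HC (1/2) (eta_bal (1/2) t) (rho_bal (1/2) t) z = s \<longleftrightarrow>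
                 P_HC (1/2) (eta_bal (1/2) t) (rho_bal (1/2) t) z = (s - \<tau>) / (1 - \<tau>)) \<and>
              (Gamma_HC (1/2) (eta_bal (1/2) t) (rho_bal (1/2) t) z = s \<longleftrightarrow>
                 (E_HC z)\<^sup>2 = (1 + \<tau>) * (s - \<tau>))) \<and>
           (1/2, eta_bal (1/2) t, rho_bal (1/2) t, z_bal (1/2) t \<delta>) \<in> D_HC \<and>
           Gamma_HC (1/2) (eta_bal (1/2) t) (rho_bal (1/2) t) (z_bal (1/2) t \<delta>) = s \<and>
           P_bal (1/2) t \<delta> = (s - \<tau>) / (1 - \<tau>) \<and>
           (E_bal (1/2) t \<delta>)\<^sup>2 = (1 + \<tau>) * (s - \<tau>) \<and>
           Phi_bal (1/2) t \<delta> = F \<delta> \<tau>)) \<and>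
     Inf {Phi_HC x \<eta> \<rho> z | x \<eta> \<rho> z.
        (x, \<eta>, \<rho>, z) \<in> D_HC \<and> x = 1/2 \<and> \<eta> = \<rho> \<and> Gamma_HC x \<eta> \<rho> z > s} = M2 \<delta> \<and>
     kappa_HC \<delta> \<le> kappa_bal \<delta> \<and> kappa_bal \<delta> \<le> M2 \<delta>"
proof (intro conjI allI impI, goal_cases)
  case (1 t \<tau>)
  then show ?case
    by (simp add: eta_bal_half)
next
  case (2 t \<tau>)
  then show ?case
    by (simp add: eta_bal_half)
next
  case (3 t \<tau> z)
  then interpret symmetric_balanced_point t \<tau> \<delta>
    by unfold_locales (use assms in auto)
  show ?case
    using symmetric_boundary_iff(1)[OF _ _ eta_bal_half_sin] eta_rho_bal_bounds
    by (simp add: eta_bal_half)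
next
  case (4 t \<tau> z)
  then interpret symmetric_balanced_point t \<tau> \<delta>
    by unfold_locales (use assms in auto)
  show ?case
    using symmetric_boundary_iff(2)[OF _ _ eta_bal_half_sin] eta_rho_bal_bounds
    by (simp add: eta_bal_half)
next
  case (5 t \<tau>)
  then interpret symmetric_balanced_point t \<tau> \<delta>
    by unfold_locales (use assms in auto)
  show ?case
    by (rule bal_in_D_HC[OF P_bal_half_bounds E_bal_half_bounds(2)])
next
  case (6 t \<tau>)
  then interpret symmetric_balanced_point t \<tau> \<delta>
    by unfold_locales (use assms in auto)
  show ?case
    using Gamma_HC_bal[OF P_bal_half_bounds(1)] assms by simp
next
  case (7 t \<tau>)
  then interpret symmetric_balanced_point t \<tau> \<delta>
    by unfold_locales (use assms in auto)
  show ?case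
    using P_bal_half assms by simp
next
  case (8 t \<tau>)
  then interpret symmetric_balanced_point t \<tau> \<delta>
    by unfold_locales (use assms in auto)
  show ?case
    using E_bal_half_sq assms by simp
next
  case (9 t \<tau>)
  then interpret symmetric_balanced_point t \<tau> \<delta>
    by unfold_locales (use assms in auto)
  show ?case
    by (rule Phi_bal_half)
next
  case 10
  show ?case
    using Inf_symmetric_slice assms by simp
next
  case 11
  show ?case
    using kappa_HC_le_kappa_bal assms by simp
next
  case 12
  show ?case
    using kappa_bal_le_M2 assms by simp
qed

end
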